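(* Let $d$ be odd and let $c_1\ge c_2\ge\cdots\ge c_u$ ($u\ge0$) be odd positive integers with $c_1\le d$. Let $H=H_d(c_1,\dots,c_u)$ be the partial $d$-closure $C_d(A(0,c_1,\dots,c_u,1))$ of the ascent algebra $A(0,c_1,\dots,c_u,1)$. Then $H$ is a concave linear Nakayama algebra which is a higher Auslander algebra of global dimension $d$, and $\operatorname{char}(\operatorname{rad}P/\operatorname{soc}P)=(c_1,\dots,c_u)$, where $P$ is the first summit of $H$.
   Context: Conventions: $k$ a field; Nakayama algebras are basic $kQ/I$ with $Q$ a linearly oriented path (linear) or oriented cycle; modules are finitely generated left modules, indecomposables are uniserial; $|M|$ length, $\operatorname{pd}$ projective dimension, $\tau$ Auslander–Reiten translation, $PM$ projective cover. For a linear Nakayama algebra $A$ the simples are $S_1,\dots,S_n$ with $\tau S_i=S_{i-1}$, and $\omega_A=S_n$ is the simple injective. An indecomposable module is even/odd according to the parity of its projective dimension. For indecomposable $M$ with composition factors $F_1=\operatorname{soc}M,\dots,F_m=\operatorname{top}M$ (from bottom to top), $\operatorname{char}M=(z_1,\dots,z_m)$ where $z_i=\operatorname{pd}F_i$ if $F_i$ is odd and $z_i=\operatorname{pd}M$ if $F_i$ is even; $\operatorname{char}0=()$. Height, summits: maximal length of indecomposables, and indecomposables of that length. Concave: Kupisch series $(|PS_1|,\dots,|PS_n|)$ weakly increases then weakly decreases; first summit: the summit $P$ with $\operatorname{rad}P$ projective. Higher Auslander algebra: global dimension equals dominant dimension (dominant dimension = number of initial projective terms in a minimal injective coresolution of ${}_AA$).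 Ascent algebra: a projective characteristic sequence is a finite sequence of non-negative integers with exactly one even entry, this entry being $0$. A linear Nakayama algebra is ascending if its Kupisch series is weakly increasing. For each projective characteristic sequence $\mathbf z$ there is a unique (up to isomorphism) ascending linear Nakayama algebra $A(\mathbf z)$ with $\operatorname{char}P(\omega_{A(\mathbf z)})=\mathbf z$. Partial $d$-closure: a simple $A$-module $S$ is $d$-closed if $S$ is torsionless (a submodule of a projective module) or there is a module $M$ with $\operatorname{soc}M=S$ and $\operatorname{pd}M\ge d$. The $d$-cliff module of $A$ is $Y_A=P(\omega_A)/U$, $U$ the largest submodule of $P(\omega_A)$ all of whose composition factors are $d$-closed. If $Y_A\ne0$, $E_d(A)=A[Y_A]$ is the one-point extension: the linear Nakayama algebra with one more simple $T=\tau^{-}\omega_A$ and $\operatorname{rad}P(T)\cong Y_A$ (Kupisch series extended by $|Y_A|+1$); if $Y_A=0$, $E_d(A)=A$. The partial $d$-closure is $C_d(A)=E_d^t(A)$ for any $t$ such that the $d$-cliff module of $E_d^t(A)$ is zero. *)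

theory Defs
  imports Main "HOL-Library.Extended_Nat"
begin

text \<open>A linear Nakayama algebra with simples S_1,...,S_n (tau S_i = S_(i-1), S_n simple
injective) is encoded by its Kupisch series K = [|P S_1|, ..., |P S_n|] (list, 1-indexed via kup).
P(S_i) is uniserial with composition factors S_(i-|PS_i|+1) (socle), ..., S_i (top).
An indecomposable module is the interval [a,b]: socle S_a, top S_b, length b+1-a.\<close>

type_synonym kupisch = "nat list"

definition kup :: "kupisch \<Rightarrow> nat \<Rightarrow> nat" where
  "kup K i = K ! (i - 1)"

definition lin_nakayama :: "kupisch \<Rightarrow> bool" where
  "lin_nakayama K \<longleftrightarrow> 1 \<le> length K \<and> kup K 1 = 1 \<and>
     (\<forall>i. 2 \<le> i \<and> i \<le> length K \<longrightarrow> 2 \<le> kup K i \<and> kup K i \<le> kup K (i - 1) + 1)"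

text \<open>Indecomposable module [a,b] (socle S_a, top S_b): a quotient of P(S_b).\<close>
definition is_ind :: "kupisch \<Rightarrow> nat \<Rightarrow> nat \<Rightarrow> bool" where
  "is_ind K a b \<longleftrightarrow> 1 \<le> a \<and> a \<le> b \<and> b \<le> length K \<and> b + 1 - a \<le> kup K b"

definition is_proj_ind :: "kupisch \<Rightarrow> nat \<Rightarrow> nat \<Rightarrow> bool" where
  "is_proj_ind K a b \<longleftrightarrow> is_ind K a b \<and> kup K b = b + 1 - a"

text \<open>Projective dimension: the syzygy of [a,b] (non-projective) is [b+1-|PS_b|, a-1].\<close>
function pd :: "kupisch \<Rightarrow> nat \<Rightarrow> nat \<Rightarrow> nat" where
  "pd K a b = (if \<not> is_ind K a b \<or> kup K b \<le> b + 1 - a then 0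
               else Suc (pd K (b + 1 - kup K b) (a - 1)))"
  by pat_completeness auto
termination
  by (relation "measure (\<lambda>(K, a, b). b)") (auto simp: is_ind_def)

definition gldim :: "kupisch \<Rightarrow> nat" where
  "gldim K = Max {pd K a b | a b. is_ind K a b}"

text \<open>Injective envelope of [a,b] is [a, inj_end K a].\<close>
definition inj_end :: "kupisch \<Rightarrow> nat \<Rightarrow> nat" where
  "inj_end K a = Max {b. is_ind K a b}"

text \<open>Dominant dimension of an indecomposable module: number of initial projective(-injective)
terms of its minimal injective coresolution (cosyzygy of [a,b] is [b+1, inj_end K a]).\<close>
function domdim_mod :: "kupisch \<Rightarrow> nat \<Rightarrow> nat \<Rightarrow> enat" where
  "domdim_mod K a b =
     (if \<not> is_ind K a b then \<infinity>
      else if \<not> is_proj_ind K a (inj_end K a) then 0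
      else if inj_end K a = b then \<infinity>
      else eSuc (domdim_mod K (Suc b) (inj_end K a)))"
  by pat_completeness auto
termination
  by (relation "measure (\<lambda>(K, a, b). Suc (length K) - a)") (auto simp: is_ind_def)

definition domdim :: "kupisch \<Rightarrow> enat" where
  "domdim K = (INF i \<in> {1..length K}. domdim_mod K (i + 1 - kup K i) i)"

definition higher_auslander :: "kupisch \<Rightarrow> bool" where
  "higher_auslander K \<longleftrightarrow> enat (gldim K) = domdim K"

text \<open>char of the module [a,b] (empty list when a > b, i.e. the zero module).\<close>
definition charseq :: "kupisch \<Rightarrow> nat \<Rightarrow> nat \<Rightarrow> nat list" where
  "charseq K a b = map (\<lambda>j. if odd (pd K j j) then pd K j j else pd K a b) [a..<Suc b]"

text \<open>P(omega) = P(S_n) = [n + 1 - |PS_n|, n].\<close>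
definition pomega_soc :: "kupisch \<Rightarrow> nat" where
  "pomega_soc K = length K + 1 - kup K (length K)"

definition ascending :: "kupisch \<Rightarrow> bool" where
  "ascending K \<longleftrightarrow> sorted K"

definition ascent_alg :: "nat list \<Rightarrow> kupisch" where
  "ascent_alg z = (THE K. lin_nakayama K \<and> ascending K \<and>
                        charseq K (pomega_soc K) (length K) = z)"

text \<open>S_i is torsionless iff it is a submodule of a projective, i.e. the socle of some P(S_j).\<close>
definition torsionless_simple :: "kupisch \<Rightarrow> nat \<Rightarrow> bool" where
  "torsionless_simple K i \<longleftrightarrow> (\<exists>j \<in> {1..length K}. j + 1 - kup K j = i)"

definition d_closed :: "kupisch \<Rightarrow> nat \<Rightarrow> nat \<Rightarrow> bool" where
  "d_closed K d i \<longleftrightarrow> torsionless_simple K i \<or> (\<exists>b. is_ind K i b \<and> d \<le> pd K i b)"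

text \<open>Submodules of P(omega) = [s,n] are [s,t], s-1 \<le> t \<le> n (t = s-1: zero).
U = [s, cliff_top]; the cliff module is Y = [cliff_top + 1, n].\<close>
definition cliff_top :: "kupisch \<Rightarrow> nat \<Rightarrow> nat" where
  "cliff_top K d = Max {t. pomega_soc K - 1 \<le> t \<and> t \<le> length K \<and>
        (\<forall>j. pomega_soc K \<le> j \<and> j \<le> t \<longrightarrow> d_closed K d j)}"

definition cliff_len :: "kupisch \<Rightarrow> nat \<Rightarrow> nat" where
  "cliff_len K d = length K - cliff_top K d"

definition ext_d :: "nat \<Rightarrow> kupisch \<Rightarrow> kupisch" where
  "ext_d d K = (if cliff_len K d = 0 then K else K @ [cliff_len K d + 1])"

definition partial_closure :: "nat \<Rightarrow> kupisch \<Rightarrow> kupisch" where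
  "partial_closure d K = (ext_d d ^^ (LEAST t. cliff_len ((ext_d d ^^ t) K) d = 0)) K"

definition concave :: "kupisch \<Rightarrow> bool" where
  "concave K \<longleftrightarrow> (\<exists>m. (\<forall>i j. 1 \<le> i \<and> i \<le> j \<and> j \<le> m \<and> j \<le> length K \<longrightarrow> kup K i \<le> kup K j) \<and>
                      (\<forall>i j. m \<le> i \<and> i \<le> j \<and> j \<le> length K \<longrightarrow> kup K j \<le> kup K i))"

definition height :: "kupisch \<Rightarrow> nat" where
  "height K = Max {b + 1 - a | a b. is_ind K a b}"

definition summit :: "kupisch \<Rightarrow> nat \<Rightarrow> nat \<Rightarrow> bool" where
  "summit K a b \<longleftrightarrow> is_ind K a b \<and> b + 1 - a = height K"

text \<open>rad [a,b] = [a, b-1] (zero if b = a).\<close>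
definition first_summit :: "kupisch \<Rightarrow> nat \<Rightarrow> nat \<Rightarrow> bool" where
  "first_summit K a b \<longleftrightarrow> summit K a b \<and> (b = a \<or> is_proj_ind K a (b - 1))"

end

theory Submission
  imports Defs
begin

text \<open>Adding a simple T whose projective cover has socle s' leaves all old projective dimensions unchanged, and the syzygy of [a,T] is
  the interval [s',a-1] inside P(omega). So the projective dimensions of the intervals in P(omega)
  evolve by themselves. If the simples in P(omega) have projective dimensions e, y_1, ..., y_m with
  e even and the y_i odd and decreasing, then an interval starting at y_i has dimension y_i, and
  the one from e to y_r has dimension y_(r+1) - 1. The closure discards the leading y_i equal to d
  and then turns the rest around once, raising each surviving entry by 2, until all y_i equal d.
  In the end every interval whose socle is not torsionless has projective dimension d; since a
  cosyzygy step through a projective-injective raises the projective dimension by one, every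
  coresolution of a non-injective projective has exactly d projective terms.\<close>

declare pd.simps [simp del] domdim_mod.simps [simp del]

section \<open>Kupisch series, intervals and extension by one simple\<close>

lemma lin_nakayamaD:
  assumes "lin_nakayama K" "2 \<le> i" "i \<le> length K"
  shows "2 \<le> kup K i" "kup K i \<le> kup K (i - 1) + 1"
  using assms unfolding lin_nakayama_def by auto

lemma kup_pos:
  assumes "lin_nakayama K" "1 \<le> i" "i \<le> length K"
  shows "1 \<le> kup K i"
proof (cases "i = 1")
  case True
  then show ?thesis using assms(1) by (simp add: lin_nakayama_def)
next
  case False
  then show ?thesis using lin_nakayamaD(1)[OF assms(1), of i] assms(2,3) by simp
qed

lemma kup_le:
  assumes "lin_nakayama K" "1 \<le> i" "i \<le> length K"
  shows "kup K i \<le> i"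
  using assms(2,3)
proof (induction i rule: dec_induct)
  case base
  then show ?case using assms(1) by (simp add: lin_nakayama_def)
next
  case (step i)
  then show ?case using lin_nakayamaD(2)[OF assms(1), of "Suc i"] by auto
qed

text \<open>Rewritten in terms of socles, the Kupisch inequality between neighbours says that the
  socle index of P(S_i) cannot drop when i grows by one.\<close>

lemma proj_soc_mono:
  assumes "lin_nakayama K" "1 \<le> i" "i \<le> j" "j \<le> length K"
  shows "i + 1 - kup K i \<le> j + 1 - kup K j"
  using assms(3,4)
proof (induction j rule: dec_induct)
  case (step j)
  then show ?case using lin_nakayamaD(2)[OF assms(1), of "Suc j"] assms(2) by auto
qed simp

lemma is_ind_proj:
  assumes "lin_nakayama K" "1 \<le> i" "i \<le> length K"
  shows "is_ind K (i + 1 - kup K i) i" "is_proj_ind K (i + 1 - kup K i) i"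
  using kup_le[OF assms] kup_pos[OF assms] assms by (auto simp: is_ind_def is_proj_ind_def)

lemma kup_snoc:
  "1 \<le> i \<Longrightarrow> i \<le> length K \<Longrightarrow> kup (K @ [k]) i = kup K i"
  "kup (K @ [k]) (Suc (length K)) = k"
  by (auto simp: kup_def nth_append)

lemma kup_append: "1 \<le> i \<Longrightarrow> i \<le> length K \<Longrightarrow> kup (K @ E) i = kup K i"
  by (auto simp: kup_def nth_append)

lemma lin_nakayama_snoc:
  assumes "lin_nakayama K" "2 \<le> k" "k \<le> kup K (length K) + 1"
  shows "lin_nakayama (K @ [k])"
proof -
  have "2 \<le> kup (K @ [k]) i \<and> kup (K @ [k]) i \<le> kup (K @ [k]) (i - 1) + 1"
    if "2 \<le> i" "i \<le> Suc (length K)" for i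
  proof (cases "i = Suc (length K)")
    case True
    then show ?thesis using assms that by (auto simp: kup_snoc)
  next
    case False
    then show ?thesis using lin_nakayamaD[OF assms(1), of i] that by (auto simp: kup_snoc)
  qed
  moreover have "kup (K @ [k]) 1 = 1" "1 \<le> length K"
    using assms(1) by (auto simp: kup_snoc lin_nakayama_def)
  ultimately show ?thesis by (simp add: lin_nakayama_def)
qed

lemma is_ind_append: "b \<le> length K \<Longrightarrow> is_ind (K @ E) a b = is_ind K a b"
  by (auto simp: is_ind_def kup_append)

text \<open>All syzygies of an interval lie to its left, so its resolution reads only Kupisch
  entries up to its top.\<close>

lemma pd_append: "b \<le> length K \<Longrightarrow> pd (K @ E) a b = pd K a b"
proof (induction K a b rule: pd.induct)
  case (1 K a b)
  show ?case
  proof (cases "\<not> is_ind K a b \<or> kup K b \<le> b + 1 - a")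
    case True
    then show ?thesis using 1(2)
      by (subst (1 2) pd.simps) (auto simp: is_ind_append kup_append is_ind_def)
  next
    case False
    then have "kup (K @ E) b = kup K b" "a - 1 \<le> length K"
      by (auto simp: is_ind_def kup_append)
    then show ?thesis using 1 False
      by (subst (1 2) pd.simps) (auto simp: is_ind_append)
  qed
qed

lemma pd_proj: "is_proj_ind K a b \<Longrightarrow> pd K a b = 0"
  by (subst pd.simps) (auto simp: is_proj_ind_def)

text \<open>The projective cover of the last simple is the interval from s to s + m.\<close>

definition window :: "kupisch \<Rightarrow> nat \<Rightarrow> nat \<Rightarrow> bool" where
  "window K s m \<longleftrightarrow> lin_nakayama K \<and> 1 \<le> s \<and> length K = s + m \<and> kup K (s + m) = Suc m"

lemma windowD:
  assumes "window K s m"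
  shows "lin_nakayama K" "1 \<le> s" "length K = s + m" "kup K (s + m) = Suc m"
    "pomega_soc K = s"
  using assms by (auto simp: window_def pomega_soc_def)

lemma window_ex: "lin_nakayama K \<Longrightarrow> \<exists>s m. window K s m"
  using kup_le[of K "length K"] kup_pos[of K "length K"]
  by (intro exI[of _ "length K + 1 - kup K (length K)"] exI[of _ "kup K (length K) - 1"])
     (auto simp: window_def lin_nakayama_def)

lemma window_ind: "window K s m \<Longrightarrow> s \<le> a \<Longrightarrow> a \<le> s + m \<Longrightarrow> is_ind K a (s + m)"
  by (auto simp: window_def is_ind_def)

lemma window_proj: "window K s m \<Longrightarrow> is_proj_ind K s (s + m)"
  by (auto simp: window_def is_ind_def is_proj_ind_def)

text \<open>The new top is \<open>s + m + 1\<close>, so a projective cover with socle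
  \<open>s'\<close> has length \<open>s + m + 2 - s'\<close>. Its radical is the nonzero quotient
  \<open>[s', s + m]\<close> of the old P(omega), whence the range of \<open>s'\<close>.\<close>

lemma window_snoc:
  assumes "window K s m" "s \<le> s'" "s' \<le> s + m"
  shows "window (K @ [s + m + 2 - s']) s' (s + m + 1 - s')"
proof -
  have "lin_nakayama (K @ [s + m + 2 - s'])"
    using assms windowD[OF assms(1)] by (intro lin_nakayama_snoc) auto
  then show ?thesis
    using assms windowD[OF assms(1)] kup_snoc(2)[of K] by (auto simp: window_def)
qed

lemma pd_last:
  assumes "window K s m" "s < a" "a \<le> s + m"
  shows "pd K a (s + m) = Suc (pd K s (a - 1))"
  using assms windowD[OF assms(1)] window_ind[OF assms(1), of a]
  by (subst pd.simps) auto

lemma pd_snoc_last: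
  assumes "window K s m" "s \<le> s'" "s' < a" "a \<le> s + m + 1"
  shows "pd (K @ [s + m + 2 - s']) a (s + m + 1) = Suc (pd K s' (a - 1))"
proof -
  have "window (K @ [s + m + 2 - s']) s' (s + m + 1 - s')"
    using window_snoc[OF assms(1)] assms by simp
  from pd_last[OF this, of a] have
    "pd (K @ [s + m + 2 - s']) a (s + m + 1) = Suc (pd (K @ [s + m + 2 - s']) s' (a - 1))"
    using assms by simp
  then show ?thesis using assms windowD[OF assms(1)] by (simp add: pd_append)
qed

text \<open>Socles of projectives move weakly to the right and the last one is
  \<open>s\<close>.\<close>

lemma not_torsionless:
  assumes "window K s m" "s < a"
  shows "\<not> torsionless_simple K a"
proof
  assume "torsionless_simple K a"
  then obtain j where "1 \<le> j" "j \<le> length K" "j + 1 - kup K j = a"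
    by (auto simp: torsionless_simple_def)
  then show False
    using proj_soc_mono[of K j "length K"] windowD[OF assms(1)] assms(2) by auto
qed

lemma torsionless_append: "torsionless_simple K a \<Longrightarrow> torsionless_simple (K @ E) a"
  by (force simp: torsionless_simple_def kup_append)

lemma window_torsionless: "window K s m \<Longrightarrow> torsionless_simple K s"
  unfolding torsionless_simple_def using windowD[of K s m]
  by (intro bexI[of _ "s + m"]) auto

section \<open>Uniqueness of the ascent algebra\<close>

abbreviation char_omega :: "kupisch \<Rightarrow> nat list" where
  "char_omega K \<equiv> charseq K (pomega_soc K) (length K)"

lemma char_omega_window:
  assumes "window K s m"
  shows "char_omega K = map (\<lambda>j. if odd (pd K j j) then pd K j j else 0) [s..<Suc (s + m)]"
  using windowD[OF assms] pd_proj[OF window_proj[OF assms]] by (simp add: charseq_def)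

lemma length_char_omega: "window K s m \<Longrightarrow> length (char_omega K) = Suc m"
  by (subst char_omega_window) auto

text \<open>The syzygy of the new simple is the old P(omega), which is projective.\<close>

lemma char_omega_snoc_grow:
  assumes "window K s m"
  shows "char_omega (K @ [m + 2]) = char_omega K @ [1]"
proof -
  have w: "window (K @ [m + 2]) s (Suc m)" using window_snoc[OF assms, of s] by simp
  have "pd (K @ [m + 2]) (Suc (s + m)) (Suc (s + m)) = 1"
    using pd_snoc_last[OF assms, of s "Suc (s + m)"] pd_proj[OF window_proj[OF assms]] by simp
  then show ?thesis
    unfolding char_omega_window[OF w] char_omega_window[OF assms]
    using windowD[OF assms] by (simp add: pd_append)
qed

text \<open>The syzygy of the new simple is the old window without its bottom, and the syzygy of
  that is the bottom simple. So the departing simple returns on top with dimension raised by 2 and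
  the same parity.\<close>

lemma char_omega_snoc_rotate:
  assumes "window K s m" "1 \<le> m"
  shows "char_omega (K @ [m + 1]) = tl (char_omega K) @
    [if odd (hd (char_omega K)) then hd (char_omega K) + 2 else 0]"
proof -
  have w: "window (K @ [m + 1]) (Suc s) m" using window_snoc[OF assms(1), of "Suc s"] assms by simp
  have "pd (K @ [m + 1]) (Suc (s + m)) (Suc (s + m)) = Suc (Suc (pd K s s))"
    using pd_snoc_last[OF assms(1), of "Suc s" "Suc (s + m)"] pd_last[OF assms(1), of "Suc s"]
      assms(2) by simp
  moreover have "pd (K @ [m + 1]) j j = pd K j j" if "j \<in> set [Suc s..<Suc (s + m)]" for j
    using that windowD[OF assms(1)] by (intro pd_append) auto
  then have "map (\<lambda>j. if odd (pd (K @ [m + 1]) j j) then pd (K @ [m + 1]) j j else 0) [Suc s..<Suc (s + m)]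
      = map (\<lambda>j. if odd (pd K j j) then pd K j j else 0) [Suc s..<Suc (s + m)]"
    by (intro map_cong) auto
  moreover have "[s..<Suc (s + m)] = s # [Suc s..<Suc (s + m)]"
    by (rule upt_rec[THEN trans]) simp
  moreover have "[Suc s..<Suc (Suc s + m)] = [Suc s..<Suc (s + m)] @ [Suc (s + m)]" by simp
  ultimately show ?thesis
    unfolding char_omega_window[OF w] char_omega_window[OF assms(1)]
    by (simp del: upt_Suc)
qed

lemma lin_nakayama_butlast:
  assumes "lin_nakayama (K @ [k])" "K \<noteq> []"
  shows "lin_nakayama K" "2 \<le> k" "k \<le> kup K (length K) + 1"
proof -
  have "2 \<le> kup (K @ [k]) i \<and> kup (K @ [k]) i \<le> kup (K @ [k]) (i - 1) + 1"
    if "2 \<le> i" "i \<le> Suc (length K)" for i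
    using lin_nakayamaD[OF assms(1), of i] that by auto
  from this[of "Suc (length K)"] show "2 \<le> k" "k \<le> kup K (length K) + 1"
    using assms(2) by (auto simp: kup_snoc Suc_le_eq)
  have "kup K i = kup (K @ [k]) i" if "1 \<le> i" "i \<le> length K" for i
    using that by (simp add: kup_snoc)
  then show "lin_nakayama K"
    using assms lin_nakayamaD[OF assms(1)] unfolding lin_nakayama_def
    by (auto simp: Suc_le_eq)
qed

text \<open>The last Kupisch entry may not fall and can rise by at most one, which leaves two kinds
  of extension: grow or rotate.\<close>

lemma ascending_snoc_cases:
  assumes "lin_nakayama (K @ [k])" "ascending (K @ [k])" "K \<noteq> []"
  obtains s m where "window K s m" "k = m + 2"
    | s m where "window K s m" "k = m + 1" "1 \<le> m"
proof -
  note l = lin_nakayama_butlast[OF assms(1,3)]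
  obtain s m where w: "window K s m" using window_ex[OF l(1)] by blast
  have "kup K (length K) \<in> set K" using assms(3) by (simp add: kup_def)
  then have "kup K (length K) \<le> k" using assms(2) by (auto simp: ascending_def sorted_append)
  then consider "k = m + 2" | "k = m + 1" "1 \<le> m" using l windowD[OF w] by fastforce
  then show thesis using that w by cases blast+
qed

text \<open>The character of an extension determines whether the last entry was appended (it is 1) or
  rotated (it is not 1), hence the previous character.\<close>

lemma char_omega_inj:
  assumes "lin_nakayama K" "ascending K" "lin_nakayama L" "ascending L"
    and "char_omega K = char_omega L"
  shows "K = L"
  using assms
proof (induction K arbitrary: L rule: rev_induct)
  case Nil
  then show ?case by (simp add: lin_nakayama_def)
next
  case (snoc k K)
  obtain l L' where L: "L = L' @ [l]"
    using snoc.prems(3) by (cases L rule: rev_cases) (auto simp: lin_nakayama_def)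
  \<comment> \<open>The length of P(omega) is both the last Kupisch entry and the length of the
    character, so equal characters force equal last entries.\<close>
  have len: "length (char_omega M) = kup M (length M)" if "lin_nakayama M" for M
    using window_ex[OF that] by (metis length_char_omega windowD(3,4))
  have "kup (K @ [k]) (Suc (length K)) = kup (L' @ [l]) (Suc (length L'))"
    using len[OF snoc.prems(1)] len[OF snoc.prems(3)] snoc.prems(5) L by simp
  then have kl: "k = l" by (simp add: kup_snoc)
  have "K = L'"
  proof (cases "K = [] \<or> L' = []")
    case True
    have one: "k = 1" if "lin_nakayama [k]" for k using that by (auto simp: lin_nakayama_def kup_def)
    have "K = []" "L' = []"
      using True one snoc.prems(1,3) L kl lin_nakayama_butlast(2)[of K k]
        lin_nakayama_butlast(2)[of L' l] by fastforce+
    then show ?thesis by simp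
  next
    case False
    have IH: "K = L'" if "char_omega K = char_omega L'"
      using snoc.IH[OF _ _ _ _ that] False snoc.prems L lin_nakayama_butlast(1)
      by (auto simp: ascending_def sorted_append)
    \<comment> \<open>An even simple enters the character as the dimension 0 of P(omega). Hence the
      head is odd or 0, and can be recovered from the entry it becomes under rotation.\<close>
    have hd0: "odd (hd (char_omega M)) \<or> hd (char_omega M) = 0" if "window M s m" for M s m
      using char_omega_window[OF that] by (simp add: hd_map del: upt_Suc)
    have ne: "char_omega M \<noteq> []" if "window M s m" for M s m
      using length_char_omega[OF that] by auto
    have K: "K \<noteq> []" "L' \<noteq> []" using False by auto
    show ?thesis
    proof (rule ascending_snoc_cases[OF snoc.prems(1,2) K(1)])
      fix s m assume A: "window K s m" "k = m + 2"
      show ?thesis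
      proof (rule ascending_snoc_cases[OF snoc.prems(3,4)[unfolded L] K(2)])
        fix s' m' assume B: "window L' s' m'" "l = m' + 2"
        then show ?thesis using A snoc.prems(5) L char_omega_snoc_grow IH by fastforce
      next
        fix s' m' assume B: "window L' s' m'" "l = m' + 1" "1 \<le> m'"
        then show ?thesis
          using A snoc.prems(5) L char_omega_snoc_grow[OF A(1)] char_omega_snoc_rotate[OF B(1,3)]
          by (auto split: if_splits)
      qed
    next
      fix s m assume A: "window K s m" "k = m + 1" "1 \<le> m"
      show ?thesis
      proof (rule ascending_snoc_cases[OF snoc.prems(3,4)[unfolded L] K(2)])
        fix s' m' assume B: "window L' s' m'" "l = m' + 2"
        then show ?thesis
          using A snoc.prems(5) L char_omega_snoc_grow[OF B(1)] char_omega_snoc_rotate[OF A(1,3)]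
          by (auto split: if_splits)
      next
        fix s' m' assume B: "window L' s' m'" "l = m' + 1" "1 \<le> m'"
        have "tl (char_omega K) = tl (char_omega L') \<and> hd (char_omega K) = hd (char_omega L')"
          using A B snoc.prems(5) L char_omega_snoc_rotate[OF B(1,3)] hd0[OF A(1)] hd0[OF B(1)]
            char_omega_snoc_rotate[OF A(1,3)] by (auto split: if_splits)
        then show ?thesis using IH ne[OF A(1)] ne[OF B(1)] list.expand by blast
      qed
    qed
  qed
  then show ?case using L kl by simp
qed

section \<open>Projective dimensions in the window of the last projective\<close>

text \<open>Here \<open>ys\<close> lists the dimensions of the simples above the bottom one, which is even;
  a successor is used instead of subtracting 1 on the right.\<close>

definition even_head :: "kupisch \<Rightarrow> nat \<Rightarrow> nat list \<Rightarrow> bool" where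
  "even_head K s ys \<longleftrightarrow> window K s (length ys) \<and>
     (\<forall>i j. i \<le> j \<and> j < length ys \<longrightarrow> pd K (s + i + 1) (s + j + 1) = ys ! i) \<and>
     (\<forall>j < length ys. Suc (pd K s (s + j)) = ys ! j)"

text \<open>The window reads x_(q+1), ..., x_m, e, x_1 + 2, ..., x_q + 2, with e the even simple.
  In the code the x are indexed from 0.\<close>

definition turning :: "kupisch \<Rightarrow> nat \<Rightarrow> nat list \<Rightarrow> nat \<Rightarrow> bool" where
  "turning K s xs q \<longleftrightarrow> window K s (length xs) \<and> q \<le> length xs \<and>
     (\<forall>i j. q \<le> i \<and> i \<le> j \<and> j < length xs \<longrightarrow> pd K (s + i - q) (s + j - q) = xs ! i) \<and>
     (\<forall>i j. q \<le> i \<and> i \<le> length xs \<and> j \<le> q \<and> j < i \<longrightarrow>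
        pd K (s + i - q) (s + length xs - q + j) = Suc (xs ! j)) \<and>
     (\<forall>i j. i \<le> j \<and> j < q \<longrightarrow>
        pd K (s + length xs - q + i + 1) (s + length xs - q + j + 1) = xs ! i + 2)"

lemma even_headD:
  assumes "even_head K s ys"
  shows "window K s (length ys)"
    "i \<le> j \<Longrightarrow> j < length ys \<Longrightarrow> pd K (s + i + 1) (s + j + 1) = ys ! i"
    "j < length ys \<Longrightarrow> Suc (pd K s (s + j)) = ys ! j"
  using assms by (auto simp: even_head_def)

lemma turningD:
  assumes "turning K s xs q"
  shows "window K s (length xs)" "q \<le> length xs"
    "q \<le> i \<Longrightarrow> i \<le> j \<Longrightarrow> j < length xs \<Longrightarrow> pd K (s + i - q) (s + j - q) = xs ! i"
    "q \<le> i \<Longrightarrow> i \<le> length xs \<Longrightarrow> j \<le> q \<Longrightarrow> j < i \<Longrightarrow>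
       pd K (s + i - q) (s + length xs - q + j) = Suc (xs ! j)"
    "i \<le> j \<Longrightarrow> j < q \<Longrightarrow>
       pd K (s + length xs - q + i + 1) (s + length xs - q + j + 1) = xs ! i + 2"
  using assms by (auto simp: turning_def)

lemma even_head_pd:
  assumes "even_head K s ys" "s < a" "a \<le> b" "b \<le> s + length ys"
  shows "pd K a b = ys ! (a - s - 1)"
  using even_headD(2)[OF assms(1), of "a - s - 1" "b - s - 1"] assms(2-) by simp

lemma even_head_singleton: "even_head [1] 1 []"
  by (simp add: even_head_def window_def lin_nakayama_def kup_def)

text \<open>An interval ending in the new simple has an initial interval of the old window as
  syzygy. The last clause of \<open>even_head\<close> turns its dimension plus one into the entry
  wanted; the new simple itself has the projective syzygy P(omega), hence the final 1.\<close>

lemma even_head_grow: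
  assumes "even_head K s ys"
  shows "even_head (K @ [length ys + 2]) s (ys @ [1])"
proof -
  let ?m = "length ys" and ?K = "K @ [length ys + 2]"
  note w = even_headD(1)[OF assms]
  have w': "window ?K s (Suc ?m)" using window_snoc[OF w, of s] by simp
  have old: "pd ?K a b = pd K a b" if "b \<le> s + ?m" for a b
    using windowD[OF w] that by (intro pd_append) auto
  have new: "pd ?K a (s + ?m + 1) = Suc (pd K s (a - 1))" if "s < a" "a \<le> s + ?m + 1" for a
    using pd_snoc_last[OF w, of s a] that by simp
  have p: "pd K s (s + ?m) = 0" by (rule pd_proj[OF window_proj[OF w]])
  have "pd ?K (s + i + 1) (s + j + 1) = (ys @ [1]) ! i" if "i \<le> j" "j < Suc ?m" for i j
  proof (cases "j = ?m")
    case True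
    then have "pd ?K (s + i + 1) (s + j + 1) = Suc (pd K s (s + i))" using new that by simp
    also have "\<dots> = (ys @ [1]) ! i"
      using True that p even_headD(3)[OF assms, of i] by (cases "i = ?m") (auto simp: nth_append)
    finally show ?thesis .
  next
    case False
    then show ?thesis using that old even_headD(2)[OF assms, of i j] by (simp add: nth_append)
  qed
  moreover have "Suc (pd ?K s (s + j)) = (ys @ [1]) ! j" if "j < Suc ?m" for j
    using that old[of "s + j" s] p even_headD(3)[OF assms, of j]
    by (cases "j = ?m") (auto simp: nth_append)
  ultimately show ?thesis using w' by (simp add: even_head_def)
qed

text \<open>The even bottom and the first \<open>r\<close> odd entries leave. Every non-projective
  interval ending in the new simple has a syzygy starting at entry \<open>ys ! r\<close>, hence
  dimension \<open>ys ! r + 1\<close>: the new simple takes the place of e, and the turn begins with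
  \<open>q = 0\<close>.\<close>

lemma even_head_cut:
  assumes "even_head K s ys" "r < length ys"
  shows "turning (K @ [length ys - r + 1]) (s + r + 1) (drop r ys) 0"
proof -
  let ?m = "length ys" and ?K = "K @ [length ys - r + 1]"
  note w = even_headD(1)[OF assms(1)]
  have w': "window ?K (s + r + 1) (?m - r)"
    using window_snoc[OF w, of "s + r + 1"] assms(2) by (simp add: Suc_diff_le)
  have "pd ?K (s + r + 1 + i) (s + r + 1 + j) = drop r ys ! i" if "i \<le> j" "j < ?m - r" for i j
    using that pd_append[of "s + r + 1 + j" K "[?m - r + 1]" "s + r + 1 + i"] windowD[OF w]
      even_headD(2)[OF assms(1), of "r + i" "r + j"] by (simp add: add_ac)
  moreover have "pd ?K (s + r + 1 + i) (s + r + 1 + (?m - r)) = Suc (drop r ys ! 0)"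
    if "0 < i" "i \<le> ?m - r" for i
    using that pd_snoc_last[OF w, of "s + r + 1" "s + r + 1 + i"] assms(2)
      even_headD(2)[OF assms(1), of r "r + i - 1"] by (simp add: Suc_diff_le add.assoc)
  ultimately show ?thesis using w' assms(2) by (simp add: turning_def)
qed

text \<open>The bottom entry \<open>xs ! q\<close> leaves. A non-projective new interval starting at
  e or below has a syzygy ending below e, of dimension \<open>xs ! Suc q\<close>. One starting above
  e has a syzygy that runs across e, of dimension \<open>xs ! i + 1\<close>, and so gets
  \<open>xs ! i + 2\<close>; for the new simple itself \<open>i = q\<close>.\<close>

lemma turning_Suc:
  assumes "turning K s xs q" "q < length xs"
  shows "turning (K @ [length xs + 1]) (Suc s) xs (Suc q)"
proof -
  let ?m = "length xs" and ?K = "K @ [length xs + 1]"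
  note w = turningD(1)[OF assms(1)]
  have w': "window ?K (Suc s) ?m"
    using window_snoc[OF w, of "Suc s"] assms(2) by simp
  have old: "pd ?K a b = pd K a b" if "b \<le> s + ?m" for a b
    using windowD[OF w] that by (intro pd_append) auto
  have new: "pd ?K a (s + ?m + 1) = Suc (pd K (Suc s) (a - 1))"
    if "Suc s < a" "a \<le> s + ?m + 1" for a
    using pd_snoc_last[OF w, of "Suc s" a] that assms(2) by simp
  have "pd ?K (Suc s + i - Suc q) (Suc s + j - Suc q) = xs ! i"
    if "Suc q \<le> i" "i \<le> j" "j < ?m" for i j
    using that old turningD(3)[OF assms(1), of i j] by simp
  moreover have "pd ?K (Suc s + i - Suc q) (Suc s + ?m - Suc q + j) = Suc (xs ! j)"
    if "Suc q \<le> i" "i \<le> ?m" "j \<le> Suc q" "j < i" for i j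
  proof (cases "j = Suc q")
    case True
    have "pd ?K (s + i - q) (s + ?m + 1) = Suc (pd K (Suc s) (s + i - q - 1))"
      using that True by (intro new) auto
    then show ?thesis
      using that True turningD(3)[OF assms(1), of "Suc q" "i - 1"] assms(2) by simp
  next
    case False
    then show ?thesis using that old turningD(4)[OF assms(1), of i j] assms(2) by simp
  qed
  moreover have "pd ?K (Suc s + ?m - Suc q + i + 1) (Suc s + ?m - Suc q + j + 1) = xs ! i + 2"
    if "i \<le> j" "j < Suc q" for i j
  proof (cases "j = q")
    case True
    have "pd ?K (s + ?m - q + i + 1) (s + ?m + 1) = Suc (pd K (Suc s) (s + ?m - q + i))"
      using that True assms(2) by (subst new) auto
    then show ?thesis
      using that True turningD(4)[OF assms(1), of "Suc q" i] assms(2) by simp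
  next
    case False
    then show ?thesis using that old turningD(5)[OF assms(1), of i j] assms(2) by simp
  qed
  ultimately show ?thesis using w' assms(2) unfolding turning_def by simp
qed

lemma turning_head:
  assumes "turning K s xs (length xs)"
  shows "even_head K s (map (\<lambda>x. x + 2) xs)"
  using turningD(1)[OF assms] turningD(4)[OF assms, of "length xs"] turningD(5)[OF assms]
  by (simp add: even_head_def)

text \<open>Used to see that the simple above the bottom is not d-closed when all entries are at
  most d - 2, so that a closure step discards the bottom only.\<close>

lemma turning_pd_Suc_soc:
  assumes "turning K s xs q" "q < length xs" "Suc s \<le> b" "b \<le> s + length xs"
  shows "\<exists>x \<in> set xs. pd K (Suc s) b \<le> Suc x"
proof (cases "b < s + length xs - q")
  case True
  then show ?thesis
    using turningD(3)[OF assms(1), of "Suc q" "b + q - s"] assms(3)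
    by (intro bexI[of _ "xs ! Suc q"]) auto
next
  case False
  then show ?thesis
    using turningD(4)[OF assms(1), of "Suc q" "b + q - (s + length xs)"] assms(2-)
    by (intro bexI[of _ "xs ! (b + q - (s + length xs))"]) auto
qed

lemma turning_pd_last:
  assumes "turning K s xs q" "s < a" "a \<le> s + length xs"
  shows "\<exists>x \<in> set xs. pd K a (s + length xs) \<le> x + 2"
proof (cases "a \<le> s + length xs - q")
  case True
  then show ?thesis
    using turningD(2)[OF assms(1)] turningD(4)[OF assms(1), of "a + q - s" q] assms(2)
    by (intro bexI[of _ "xs ! q"]) auto
next
  case False
  let ?i = "a + q - (s + length xs + 1)"
  have i: "?i \<le> q - 1" "q - 1 < q" "?i < length xs"
    and eq: "s + length xs - q + ?i + 1 = a" "s + length xs - q + (q - 1) + 1 = s + length xs"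
    using False assms(3) turningD(2)[OF assms(1)] by auto
  show ?thesis
    using turningD(5)[OF assms(1) i(1,2), unfolded eq] i(3)
    by (intro bexI[of _ "xs ! ?i"]) auto
qed

section \<open>The partial closure\<close>

text \<open>The invariant of the closure process. Socles beyond \<open>s\<close> are left open,
  since later projectives may still make them torsionless.\<close>

definition partially_closed :: "nat \<Rightarrow> kupisch \<Rightarrow> nat \<Rightarrow> bool" where
  "partially_closed d K s \<longleftrightarrow> (\<forall>a b. is_ind K a b \<longrightarrow> pd K a b \<le> d) \<and>
     (\<forall>a b. a \<le> s \<longrightarrow> is_ind K a b \<longrightarrow> torsionless_simple K a \<or> pd K a b = d)"

text \<open>Only intervals ending in the new simple are new, and their socles are at least
  \<open>s'\<close>. The simples strictly between \<open>s\<close> and \<open>s'\<close> leave the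
  window without being the socle of a projective, so \<open>cut\<close> has to supply dimension d
  for their intervals.\<close>

lemma partially_closed_snoc:
  assumes w: "window K s m" and s': "s \<le> s'" "s' \<le> s + m" and g: "partially_closed d K s"
    and le: "\<And>a. s' < a \<Longrightarrow> a \<le> s + m + 1 \<Longrightarrow> pd (K @ [s + m + 2 - s']) a (s + m + 1) \<le> d"
    and cut: "\<And>a b. s < a \<Longrightarrow> a < s' \<Longrightarrow> a \<le> b \<Longrightarrow> b \<le> s + m \<Longrightarrow> pd K a b = d"
  shows "partially_closed d (K @ [s + m + 2 - s']) s'"
proof -
  let ?K = "K @ [s + m + 2 - s']"
  have w': "window ?K s' (s + m + 1 - s')" by (rule window_snoc[OF w s'])
  have last: "s' \<le> a" if "is_ind ?K a b" "\<not> b \<le> s + m" for a b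
    using that windowD[OF w'] windowD[OF w] s' by (auto simp: is_ind_def le_Suc_eq)
  have pdle: "pd ?K a b \<le> d" if i: "is_ind ?K a b" for a b
  proof (cases "b \<le> s + m")
    case True
    then show ?thesis using i g windowD[OF w] by (simp add: pd_append is_ind_append partially_closed_def)
  next
    case False
    then have b: "b = s + m + 1" "a \<le> s + m + 1" using i windowD[OF w] by (auto simp: is_ind_def)
    show ?thesis
    proof (cases "a = s'")
      case True
      then show ?thesis using b pd_proj[OF window_proj[OF w']] s' by simp
    next
      case False
      then show ?thesis using b le[of a] last[OF i \<open>\<not> b \<le> s + m\<close>] by simp
    qed
  qed
  moreover have "torsionless_simple ?K a \<or> pd ?K a b = d" if "a \<le> s'" "is_ind ?K a b" for a b
  proof (cases "a = s'")
    case True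
    then show ?thesis using window_torsionless[OF w'] by simp
  next
    case False
    then have b: "b \<le> s + m" using last that by fastforce
    then have i: "is_ind K a b" and p: "pd ?K a b = pd K a b"
      using that windowD[OF w] by (simp_all add: is_ind_append pd_append)
    show ?thesis
    proof (cases "a \<le> s")
      case True
      then show ?thesis using g i p torsionless_append unfolding partially_closed_def by metis
    next
      case a: False
      then show ?thesis using cut[of a b] b i p False that(1) by (auto simp: is_ind_def)
    qed
  qed
  ultimately show ?thesis by (simp add: partially_closed_def)
qed

lemma partially_closed_turning:
  assumes "window K s m" "s < s'" "s' \<le> s + m" "partially_closed d K s"
    and "turning (K @ [s + m + 2 - s']) s' xs q" "\<forall>x \<in> set xs. x + 2 \<le> d"
    and "\<And>a b. s < a \<Longrightarrow> a < s' \<Longrightarrow> a \<le> b \<Longrightarrow> b \<le> s + m \<Longrightarrow> pd K a b = d"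
  shows "partially_closed d (K @ [s + m + 2 - s']) s'"
proof (rule partially_closed_snoc[OF assms(1) _ assms(3,4) _ assms(7)])
  fix a assume a: "s' < a" "a \<le> s + m + 1"
  have "s' + length xs = s + m + 1"
    using windowD(3)[OF turningD(1)[OF assms(5)]] windowD(3)[OF assms(1)] by simp
  then show "pd (K @ [s + m + 2 - s']) a (s + m + 1) \<le> d"
    using turning_pd_last[OF assms(5), of a] a assms(6) by fastforce
qed (use assms(2) in auto)

lemma partially_closed_grow:
  assumes "even_head K s ys" "partially_closed d K s" "1 \<le> d" "\<forall>y \<in> set ys. y \<le> d"
  shows "partially_closed d (K @ [length ys + 2]) s"
proof -
  have "partially_closed d (K @ [s + length ys + 2 - s]) s"
  proof (rule partially_closed_snoc[OF even_headD(1)[OF assms(1)]])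
    fix a assume a: "s < a" "a \<le> s + length ys + 1"
    then have "pd (K @ [length ys + 2]) a (s + length ys + 1) = (ys @ [1]) ! (a - s - 1)"
      using even_head_pd[OF even_head_grow[OF assms(1)], of a "s + length ys + 1"] by simp
    moreover have "(ys @ [1]) ! (a - s - 1) \<in> set (ys @ [1])"
      using a by (intro nth_mem) auto
    ultimately show "pd (K @ [s + length ys + 2 - s]) a (s + length ys + 1) \<le> d"
      using assms(3,4) by auto
  qed (use assms(2) in auto)
  then show ?thesis by simp
qed

text \<open>The bottom of the window is torsionless, and each simple above it up to \<open>t\<close>
  is its own witness for d-closedness. The next one, if any, is not torsionless, so the bound on its
  intervals keeps it open. For \<open>t = s + m\<close> the cliff module is zero.\<close>

lemma cliff_top_eq:
  assumes w: "window K s m" and t: "s \<le> t" "t \<le> s + m"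
    and closed: "\<And>j. s < j \<Longrightarrow> j \<le> t \<Longrightarrow> d \<le> pd K j j"
    and open': "\<And>b. Suc t \<le> b \<Longrightarrow> b \<le> s + m \<Longrightarrow> pd K (Suc t) b < d"
  shows "cliff_top K d = t"
proof -
  have "d_closed K d j" if "s \<le> j" "j \<le> t" for j
  proof (cases "j = s")
    case True
    then show ?thesis using window_torsionless[OF w] by (simp add: d_closed_def)
  next
    case False
    have "is_ind K j j"
      using that t windowD[OF w] kup_pos[of K j] by (auto simp: is_ind_def)
    then show ?thesis using closed[of j] that False unfolding d_closed_def by auto
  qed
  moreover have "\<not> d_closed K d (Suc t)" if "t < s + m"
    using not_torsionless[OF w, of "Suc t"] t open' windowD[OF w]
    by (fastforce simp: d_closed_def is_ind_def)
  then have "u \<le> t" if "u \<le> s + m" "\<forall>j. s \<le> j \<and> j \<le> u \<longrightarrow> d_closed K d j" for u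
    using that t by (metis leI le_Suc_eq less_le_trans not_less_eq_eq le_trans)
  ultimately show ?thesis
    unfolding cliff_top_def using windowD[OF w] t
    by (intro Max_eqI) (auto intro: finite_subset[of _ "{..s + m}"])
qed

lemma ext_d_eq:
  assumes "window K s m" "s \<le> t" "t < s + m"
    and "\<And>j. s < j \<Longrightarrow> j \<le> t \<Longrightarrow> d \<le> pd K j j"
    and "\<And>b. Suc t \<le> b \<Longrightarrow> b \<le> s + m \<Longrightarrow> pd K (Suc t) b < d"
  shows "ext_d d K = K @ [s + m - t + 1]"
  using cliff_top_eq[OF assms(1,2) _ assms(4,5)] assms(3) windowD[OF assms(1)]
  by (simp add: ext_d_def cliff_len_def)

section \<open>Iterating the extension\<close>

text \<open>Records, besides the extension, that the Kupisch series does not rise; this yields the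
  falling half of concavity.\<close>

definition ext_step :: "nat \<Rightarrow> kupisch \<Rightarrow> kupisch \<Rightarrow> bool" where
  "ext_step d K L \<longleftrightarrow> L = ext_d d K \<and> (\<exists>k \<le> kup K (length K). L = K @ [k])"

lemma ext_steps_iterate: "(ext_step d)\<^sup>*\<^sup>* K L \<Longrightarrow> \<exists>t. L = (ext_d d ^^ t) K"
proof (induction rule: rtranclp_induct)
  case base
  show ?case by (rule exI[of _ 0]) simp
next
  case (step L M)
  then obtain t where "M = (ext_d d ^^ Suc t) K" by (auto simp: ext_step_def)
  then show ?case by blast
qed

lemma ext_steps_kupisch:
  assumes "(ext_step d)\<^sup>*\<^sup>* K L" "1 \<le> length K"
  shows "\<exists>E. L = K @ E \<and>
    (\<forall>i j. length K \<le> i \<and> i \<le> j \<and> j \<le> length L \<longrightarrow> kup L j \<le> kup L i)"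
  using assms(1)
proof (induction rule: rtranclp_induct)
  case base
  have "kup K j \<le> kup K i" if "length K \<le> i" "i \<le> j" "j \<le> length K" for i j
    using that by (metis le_antisym le_refl le_trans)
  then show ?case by simp
next
  case (step L M)
  then obtain E k where E: "L = K @ E" "M = L @ [k]" "k \<le> kup L (length L)"
    and fall: "\<And>i j. length K \<le> i \<Longrightarrow> i \<le> j \<Longrightarrow> j \<le> length L \<Longrightarrow> kup L j \<le> kup L i"
    by (auto simp: ext_step_def)
  have "kup M j \<le> kup M i" if "length K \<le> i" "i \<le> j" "j \<le> length M" for i j
  proof (cases "j \<le> length L")
    case True
    then show ?thesis using that fall[of i j] E(2) assms(2) by (simp add: kup_snoc)
  next
    case False
    then have j: "j = Suc (length L)" using that E by simp
    show ?thesis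
    proof (cases "i = j")
      case False
      then show ?thesis
        using j that fall[of i "length L"] E(2,3) assms(2) by (simp add: kup_snoc)
    qed simp
  qed
  then show ?case using E by auto
qed

text \<open>The least stopping index may be smaller than the number of steps taken, but an algebra
  with zero cliff module is fixed by \<open>ext_d\<close>, so the results agree.\<close>

lemma partial_closure_eq:
  assumes "(ext_step d)\<^sup>*\<^sup>* K L" "cliff_len L d = 0"
  shows "partial_closure d K = L"
proof -
  obtain t where t: "L = (ext_d d ^^ t) K" using ext_steps_iterate[OF assms(1)] by blast
  define u where "u = (LEAST t. cliff_len ((ext_d d ^^ t) K) d = 0)"
  have u: "cliff_len ((ext_d d ^^ u) K) d = 0" "u \<le> t"
    unfolding u_def using assms(2) t by (auto intro: LeastI Least_le)
  have "ext_d d ((ext_d d ^^ u) K) = (ext_d d ^^ u) K"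
    unfolding ext_d_def[of d "(ext_d d ^^ u) K"] using u(1) by (rule if_P)
  then have "(ext_d d ^^ i) ((ext_d d ^^ u) K) = (ext_d d ^^ u) K" for i
    by (induction i) auto
  from this[of "t - u"] have "(ext_d d ^^ t) K = (ext_d d ^^ u) K"
    using u(2) by (metis add.commute comp_apply funpow_add le_add_diff_inverse)
  then show ?thesis using t by (simp add: partial_closure_def u_def)
qed

text \<open>Each step trades the bottom simple for a new top one, so the window keeps its length and
  the appended Kupisch entries are all equal. The bound \<open>x + 2 \<le> d\<close> makes each of
  these steps a closure step.\<close>

lemma turning_run:
  assumes "turning K s xs q" "partially_closed d K s" "\<forall>x \<in> set xs. x + 2 \<le> d"
  shows "\<exists>s'. (ext_step d)\<^sup>*\<^sup>* K (K @ replicate (length xs - q) (length xs + 1)) \<and>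
    even_head (K @ replicate (length xs - q) (length xs + 1)) s' (map (\<lambda>x. x + 2) xs) \<and>
    partially_closed d (K @ replicate (length xs - q) (length xs + 1)) s'"
  using assms(1,2)
proof (induction "length xs - q" arbitrary: K s q)
  case 0
  then have "q = length xs" using turningD(2) by fastforce
  then show ?case using 0 turning_head by auto
next
  case (Suc n)
  let ?m = "length xs" and ?K = "K @ [length xs + 1]"
  have q: "q < ?m" using Suc.hyps(2) by simp
  note w = turningD(1)[OF Suc.prems(1)]
  note t = turning_Suc[OF Suc.prems(1) q]
  have "partially_closed d (K @ [s + ?m + 2 - Suc s]) (Suc s)"
    using t q assms(3) by (intro partially_closed_turning[OF w _ _ Suc.prems(2)]) auto
  then have g: "partially_closed d ?K (Suc s)" by simp
  have "ext_d d K = K @ [s + ?m - s + 1]"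
  proof (rule ext_d_eq[OF w])
    fix b assume b: "Suc s \<le> b" "b \<le> s + ?m"
    then show "pd K (Suc s) b < d"
      using turning_pd_Suc_soc[OF Suc.prems(1) q b] assms(3) by fastforce
  qed (use q in auto)
  then have step: "ext_step d K ?K" using windowD[OF w] by (simp add: ext_step_def)
  have n: "n = ?m - Suc q" and m: "?m - q = Suc n" using Suc.hyps(2) by auto
  have "K @ replicate (?m - q) (?m + 1) = ?K @ replicate (?m - Suc q) (?m + 1)"
    using n m by simp
  then show ?case
    using Suc.hyps(1)[OF n t g] converse_rtranclp_into_rtranclp[of "ext_step d", OF step] by metis
qed

text \<open>The leading entries equal to d are d-closed and are cut off together with the even
  bottom; then the remaining ones make a full turn. The cut contributes one Kupisch entry and the
  turn \<open>length ys - r\<close> more.\<close>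

lemma even_head_run:
  assumes "even_head K s ys" "partially_closed d K s" "r < length ys"
    and "\<forall>i < r. ys ! i = d" "\<forall>y \<in> set (drop r ys). y + 2 \<le> d"
  defines "L \<equiv> K @ replicate (Suc (length ys - r)) (Suc (length ys - r))"
  shows "\<exists>s'. (ext_step d)\<^sup>*\<^sup>* K L \<and> even_head L s' (map (\<lambda>y. y + 2) (drop r ys)) \<and> partially_closed d L s'"
proof -
  let ?m = "length ys" and ?K = "K @ [length ys - r + 1]"
  note w = even_headD(1)[OF assms(1)]
  note t = even_head_cut[OF assms(1,3)]
  have eq: "s + ?m + 2 - (s + r + 1) = ?m - r + 1" using assms(3) by simp
  have pdd: "pd K a b = d" if "s < a" "a < s + r + 1" "a \<le> b" "b \<le> s + ?m" for a b
    using that even_head_pd[OF assms(1), of a b] assms(4) by simp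
  have "partially_closed d (K @ [s + ?m + 2 - (s + r + 1)]) (s + r + 1)"
    using t[folded eq] assms(3,5) pdd by (intro partially_closed_turning[OF w _ _ assms(2)]) auto
  then have g: "partially_closed d ?K (s + r + 1)" using eq by simp
  have "ext_d d K = K @ [s + ?m - (s + r) + 1]"
  proof (rule ext_d_eq[OF w])
    fix b assume b: "Suc (s + r) \<le> b" "b \<le> s + ?m"
    then have "pd K (Suc (s + r)) b = drop r ys ! 0"
      using even_head_pd[OF assms(1), of "Suc (s + r)" b] assms(3) by simp
    moreover have "drop r ys ! 0 \<in> set (drop r ys)" using assms(3) by (intro nth_mem) simp
    ultimately show "pd K (Suc (s + r)) b < d" using assms(5) by fastforce
  qed (use assms(3) pdd in auto)
  then have step: "ext_step d K ?K" using windowD[OF w] assms(3) by (auto simp: ext_step_def)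
  have "L = ?K @ replicate (length (drop r ys) - 0) (length (drop r ys) + 1)"
    by (simp add: L_def)
  then show ?thesis
    using turning_run[OF t g assms(5)] converse_rtranclp_into_rtranclp[of "ext_step d", OF step]
    by metis
qed

lemma decreasing_last_le:
  assumes "sorted (rev ys)" "y \<in> set ys"
  shows "last ys \<le> (y::nat)"
  using assms by (cases ys rule: rev_cases) auto

section \<open>Reaching the ascent algebra and its closure\<close>

text \<open>The algebra is found by undoing moves: a final 1 comes from growing, and otherwise all
  entries can be lowered by 2, which a full turn with \<open>r = 0\<close> reverses. These turns are
  closure steps for d as well, so the invariant comes along.\<close>

lemma ascent_exists:
  assumes "sorted (rev ys)" "\<forall>y \<in> set ys. odd y \<and> y \<le> d" "1 \<le> d"
  shows "\<exists>K s. sorted K \<and> even_head K s ys \<and> partially_closed d K s"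
  using assms(1,2)
proof (induction "sum_list ys" arbitrary: ys rule: less_induct)
  case less
  \<comment> \<open>In an ascending series the last entry, the window length, is the largest, so
    entries no smaller than it may follow.\<close>
  have sorted_ext: "sorted (K @ replicate n k)"
    if "sorted K" "even_head K s zs" "length zs + 1 \<le> k" for K :: kupisch and s zs n k
  proof -
    have "x \<le> k" if "x \<in> set K" for x
    proof -
      have "K \<noteq> []" using that by auto
      then have "last K = kup K (length K)" by (simp add: kup_def last_conv_nth)
      moreover have "x \<le> last K" using \<open>sorted K\<close> that \<open>K \<noteq> []\<close>
        by (cases K rule: rev_cases) (auto simp: sorted_append)
      ultimately show ?thesis
        using \<open>length zs + 1 \<le> k\<close> windowD[OF even_headD(1)[OF \<open>even_head K s zs\<close>]] by simp
    qed
    then show ?thesis using that(1) by (auto simp: sorted_append)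
  qed
  consider "ys = []" | xs where "ys = xs @ [1]" | "ys \<noteq> []" "last ys \<noteq> 1"
    by (metis append_butlast_last_id)
  then show ?case
  proof cases
    case 1
    have "partially_closed d [1] 1"
      by (auto simp: partially_closed_def is_ind_def torsionless_simple_def kup_def pd_proj is_proj_ind_def)
    then show ?thesis using even_head_singleton 1 by (intro exI[of _ "[1]"] exI[of _ 1]) auto
  next
    case 2
    then obtain K s where K: "sorted K" "even_head K s xs" "partially_closed d K s"
      using less.hyps[of xs] less.prems by (auto simp: sorted_append)
    have "sorted (K @ replicate 1 (length xs + 2))" by (rule sorted_ext[OF K(1,2)]) simp
    then show ?thesis
      using even_head_grow[OF K(2)] partially_closed_grow[OF K(2,3) assms(3)] less.prems 2 by auto
  next
    case 3
    \<comment> \<open>The last entry is the smallest; being odd and not 1 it is at least 3, so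
      lowering by 2 keeps all entries odd and positive.\<close>
    have ge: "3 \<le> y \<and> y \<le> d" if "y \<in> set ys" for y
    proof -
      have "last ys \<in> set ys" using 3 by simp
      then have "odd (last ys)" using less.prems(2) by blast
      then show ?thesis
        using decreasing_last_le[OF less.prems(1) that] less.prems(2) that 3(2)
        by (auto elim!: oddE)
    qed
    define xs where "xs = map (\<lambda>y. y - 2) ys"
    have ys: "map (\<lambda>x. x + 2) xs = ys" using ge by (force simp: xs_def intro: map_idI)
    have "sum_list xs < sum_list ys"
    proof -
      have "sum_list (map (\<lambda>x. x + 2) zs) = sum_list zs + 2 * length zs" for zs :: "nat list"
        by (induction zs) auto
      from this[of xs] have "sum_list ys = sum_list xs + 2 * length xs" by (simp only: ys)
      then show ?thesis using 3(1) by (simp add: xs_def)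
    qed
    moreover have "sorted (rev xs)"
      using less.prems(1) by (simp add: xs_def rev_map sorted_map)
        (erule sorted_wrt_mono_rel[rotated], simp)
    moreover have "\<forall>x \<in> set xs. odd x \<and> x \<le> d"
      using ge less.prems(2) by (fastforce simp: xs_def)
    ultimately obtain K s where K: "sorted K" "even_head K s xs" "partially_closed d K s"
      using less.hyps[of xs] by auto
    have "0 < length xs" using 3(1) by (simp add: xs_def)
    moreover have "\<forall>x \<in> set (drop 0 xs). x + 2 \<le> d" using ge by (fastforce simp: xs_def)
    moreover have "sorted (K @ replicate (Suc (length xs)) (Suc (length xs)))"
      by (rule sorted_ext[OF K(1,2)]) simp
    ultimately show ?thesis using even_head_run[OF K(2,3), of 0] ys by auto
  qed
qed

text \<open>Every run raises the surviving entries by 2, so the total distance to d drops until all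
  entries equal d.\<close>

lemma closure_exists:
  assumes "even_head K s ys" "partially_closed d K s" "ys \<noteq> []" "sorted (rev ys)"
    and "\<forall>y \<in> set ys. odd y \<and> y \<le> d" "odd d"
  shows "\<exists>L s' m. (ext_step d)\<^sup>*\<^sup>* K L \<and> even_head L s' (replicate (Suc m) d) \<and> partially_closed d L s'"
  using assms(1-5)
proof (induction "sum_list (map (\<lambda>y. d + 1 - y) ys)" arbitrary: K s ys rule: less_induct)
  case less
  \<comment> \<open>The entries decrease and are at most d, so those equal to d form the initial
    segment cut off by the next run.\<close>
  define r where "r = length (takeWhile (\<lambda>y. y = d) ys)"
  have dw: "drop r ys = dropWhile (\<lambda>y. y = d) ys" unfolding r_def by (rule dropWhile_eq_drop[symmetric])
  have tk: "ys ! i = d" if "i < r" for i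
    using that nth_mem[of i "takeWhile (\<lambda>y. y = d) ys"] set_takeWhileD[of _ "\<lambda>y. y = d" ys]
      takeWhile_nth[of i "\<lambda>y. y = d" ys] by (auto simp: r_def)
  show ?case
  proof (cases "drop r ys = []")
    case True
    then have "ys = replicate (length ys) d"
      using tk by (intro nth_equalityI) auto
    then show ?thesis using less.prems(1-3) by (metis Suc_pred length_greater_0_conv rtranclp.rtrancl_refl)
  next
    case False
    define zs where "zs = map (\<lambda>y. y + 2) (drop r ys)"
    have so: "sorted (rev (drop r ys))"
      using less.prems(4) by (metis append_take_drop_id rev_append sorted_append)
    have "hd (drop r ys) \<noteq> d" "hd (drop r ys) \<in> set ys"
      using False hd_dropWhile[of "\<lambda>y. y = d" ys] in_set_dropD[OF hd_in_set[OF False]] by (auto simp: dw)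
    then have "hd (drop r ys) < d" using less.prems(5) by fastforce
    moreover have "y \<le> hd (drop r ys)" if "y \<in> set (drop r ys)" for y
      using so that by (cases "drop r ys") (auto simp: sorted_append)
    \<comment> \<open>Both y and d are odd, so y < d leaves room for 2.\<close>
    ultimately have lt: "y + 2 \<le> d" if "y \<in> set (drop r ys)" for y
    proof -
      have "y < d" using that \<open>hd (drop r ys) < d\<close> \<open>\<And>y. y \<in> set (drop r ys) \<Longrightarrow> y \<le> hd (drop r ys)\<close>
        by fastforce
      moreover have "odd y" using less.prems(5) in_set_dropD[OF that] by blast
      ultimately show ?thesis using assms(6) by (auto elim!: oddE)
    qed
    have "r < length ys" using False by simp
    from even_head_run[OF less.prems(1,2) this] tk lt obtain L s'
      where L: "(ext_step d)\<^sup>*\<^sup>* K L" "even_head L s' zs" "partially_closed d L s'"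
      unfolding zs_def by blast
    have "sum_list (map (\<lambda>y. d + 1 - y) zs) < sum_list (map (\<lambda>y. d + 1 - y) (drop r ys))"
    proof -
      have "sum_list (map (\<lambda>y. d + 1 - y) zs) = sum_list (map (\<lambda>y. d + 1 - (y + 2)) (drop r ys))"
        by (simp add: zs_def o_def)
      also have "\<dots> < sum_list (map (\<lambda>y. d + 1 - y) (drop r ys))"
        using False lt by (intro sum_list_strict_mono) force+
      finally show ?thesis .
    qed
    also have "\<dots> \<le> sum_list (map (\<lambda>y. d + 1 - y) ys)"
      by (subst (2) append_take_drop_id[of r ys, symmetric]) (simp del: append_take_drop_id)
    finally have "\<exists>L' s'' m. (ext_step d)\<^sup>*\<^sup>* L L' \<and> even_head L' s'' (replicate (Suc m) d) \<and> partially_closed d L' s''"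
    proof (rule less.hyps[OF _ L(2,3)])
      show "zs \<noteq> []" using False by (simp add: zs_def)
      show "sorted (rev zs)"
        using so by (simp add: zs_def rev_map sorted_map)
      show "\<forall>y \<in> set zs. odd y \<and> y \<le> d"
        using less.prems(5) lt in_set_dropD[of _ r ys] by (auto simp: zs_def)
    qed
    then show ?thesis using L(1) rtranclp_trans[of "ext_step d" K L] by blast
  qed
qed

section \<open>Dominant dimension\<close>

lemma inj_end_properties:
  assumes "is_ind K a b"
  shows "is_ind K a (inj_end K a)" "b \<le> inj_end K a"
    "is_ind K a c \<Longrightarrow> c \<le> inj_end K a"
proof -
  have "finite {b. is_ind K a b}"
    by (rule finite_subset[of _ "{..length K}"]) (auto simp: is_ind_def)
  then show "is_ind K a (inj_end K a)" "b \<le> inj_end K a" "is_ind K a c \<Longrightarrow> c \<le> inj_end K a"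
    using Max_in[of "{b. is_ind K a b}"] assms unfolding inj_end_def by (auto intro: Max_ge)
qed

text \<open>If S_a is the socle of P(S_j), its injective envelope [a,g] has g >= j. Monotonicity of
  socles puts the socle of P(S_g) at a or later, and as [a,g] is a quotient of P(S_g) the two
  coincide.\<close>

lemma torsionless_iff_injective_envelope_proj:
  assumes "lin_nakayama K" "is_ind K a b"
  shows "is_proj_ind K a (inj_end K a) \<longleftrightarrow> torsionless_simple K a"
proof
  assume "is_proj_ind K a (inj_end K a)"
  then show "torsionless_simple K a"
    by (auto simp: is_proj_ind_def is_ind_def torsionless_simple_def
        intro!: bexI[of _ "inj_end K a"])
next
  assume "torsionless_simple K a"
  then obtain j where j: "1 \<le> j" "j \<le> length K" "j + 1 - kup K j = a"
    by (auto simp: torsionless_simple_def)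
  let ?g = "inj_end K a"
  have g: "is_ind K a ?g" by (rule inj_end_properties(1)[OF assms(2)])
  have "j \<le> ?g"
    using inj_end_properties(3)[OF assms(2)] is_ind_proj(1)[OF assms(1) j(1,2)] j(3) by simp
  then have "a \<le> ?g + 1 - kup K ?g"
    using proj_soc_mono[OF assms(1) j(1), of ?g] j(3) g by (simp add: is_ind_def)
  then show "is_proj_ind K a ?g"
    using g by (auto simp: is_proj_ind_def is_ind_def)
qed

text \<open>If the injective envelope [a,g] is projective, it is the projective cover of the
  cosyzygy, whose syzygy is therefore [a,b]: a cosyzygy step costs one in dominant dimension and
  gains one in projective dimension. The coresolution stops at a socle that is not torsionless,
  where the dimension is d. The last hypothesis excludes the projective-injectives, whose dominant
  dimension is infinite.\<close>

lemma domdim_mod_add_pd: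
  assumes "lin_nakayama K"
    and nt: "\<And>a b. is_ind K a b \<Longrightarrow> torsionless_simple K a \<or> pd K a b = d"
    and "is_ind K a b" "0 < pd K a b \<or> b < inj_end K a"
  shows "domdim_mod K a b + enat (pd K a b) = enat d"
  using assms(3,4)
proof (induction "length K - a" arbitrary: a b rule: less_induct)
  case less
  let ?g = "inj_end K a"
  show ?case
  proof (cases "torsionless_simple K a")
    case False
    then have "domdim_mod K a b = 0"
      using less.prems(1) torsionless_iff_injective_envelope_proj[OF assms(1) less.prems(1)]
      by (subst domdim_mod.simps) simp
    then show ?thesis using nt[OF less.prems(1)] False by simp
  next
    case True
    then have p: "is_proj_ind K a ?g"
      using torsionless_iff_injective_envelope_proj[OF assms(1) less.prems(1)] by simp
    have "b \<noteq> ?g" using less.prems(2) pd_proj[OF p] by auto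
    then have b: "b < ?g" using inj_end_properties(2)[OF less.prems(1)] by simp
    have i: "is_ind K (Suc b) ?g" and k: "kup K ?g = ?g + 1 - a"
      using p b less.prems(1) by (auto simp: is_ind_def is_proj_ind_def)
    have "?g + 1 - kup K ?g = a" using less.prems(1) b k by (auto simp: is_ind_def)
    then have pd: "pd K (Suc b) ?g = Suc (pd K a b)"
      using i b k less.prems(1) by (subst pd.simps) (auto simp: is_ind_def)
    have "length K - Suc b < length K - a" using less.prems(1) i by (auto simp: is_ind_def)
    then have IH: "domdim_mod K (Suc b) ?g + enat (Suc (pd K a b)) = enat d"
      using less.hyps[OF _ i] pd by simp
    have "domdim_mod K a b = eSuc (domdim_mod K (Suc b) ?g)"
      using less.prems(1) p \<open>b \<noteq> ?g\<close> by (subst domdim_mod.simps) simp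
    then show ?thesis using IH by (simp add: eSuc_enat[symmetric] iadd_Suc iadd_Suc_right)
  qed
qed

lemma domdim_eq:
  assumes "lin_nakayama K"
    and nt: "\<And>a b. is_ind K a b \<Longrightarrow> torsionless_simple K a \<or> pd K a b = d"
    and "2 \<le> length K"
  shows "domdim K = enat d"
proof -
  have proj: "domdim_mod K (i + 1 - kup K i) i = (if i < inj_end K (i + 1 - kup K i) then enat d else \<infinity>)"
    if i: "1 \<le> i" "i \<le> length K" for i
  proof -
    let ?a = "i + 1 - kup K i"
    note p = is_ind_proj[OF assms(1) i]
    show ?thesis
    proof (cases "i < inj_end K ?a")
      case True
      then show ?thesis using domdim_mod_add_pd[OF assms(1) nt p(1)] pd_proj[OF p(2)]
        by (simp add: zero_enat_def[symmetric])
    next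
      case False
      then have "inj_end K ?a = i" using inj_end_properties(2)[OF p(1)] by simp
      then show ?thesis using p by (subst domdim_mod.simps) simp
    qed
  qed
  have k: "kup K 1 = 1" using assms(1) by (simp add: lin_nakayama_def)
  \<comment> \<open>The projective S_1 embeds properly in [1,2], so it is not injective and the
    infimum d is attained there.\<close>
  have "is_ind K 1 2" "is_ind K 1 1"
    using lin_nakayamaD(1)[OF assms(1), of 2] assms(3) k by (auto simp: is_ind_def)
  then have "1 < inj_end K 1" using inj_end_properties(3) by fastforce
  then have one: "domdim_mod K (1 + 1 - kup K 1) 1 = enat d"
    using proj[of 1] assms(3) k by simp
  show ?thesis
    unfolding domdim_def
  proof (rule antisym)
    show "(INF i \<in> {1..length K}. domdim_mod K (i + 1 - kup K i) i) \<le> enat d"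
      using one assms(3) by (intro INF_lower2[of 1]) auto
    show "enat d \<le> (INF i \<in> {1..length K}. domdim_mod K (i + 1 - kup K i) i)"
    proof (rule INF_greatest)
      fix i assume "i \<in> {1..length K}"
      then show "enat d \<le> domdim_mod K (i + 1 - kup K i) i" using proj[of i] by simp
    qed
  qed
qed

text \<open>Every socle beyond \<open>s\<close> lies in the window, where all intervals have
  dimension d; the invariant covers the other socles. At least one entry d is present, so the bound
  on the global dimension is attained.\<close>

lemma closed_head:
  assumes h: "even_head K s (replicate (Suc m) d)" and g: "partially_closed d K s"
  shows "cliff_len K d = 0" "gldim K = d" "domdim K = enat d"
proof -
  note w = even_headD(1)[OF h, simplified length_replicate]
  have pdd: "pd K a b = d" if "s < a" "a \<le> b" "b \<le> s + Suc m" for a b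
    using even_head_pd[OF h, of a b] that by (simp del: replicate_Suc)
  have "cliff_top K d = s + Suc m" using pdd by (intro cliff_top_eq[OF w]) auto
  then show "cliff_len K d = 0" using windowD[OF w] by (simp add: cliff_len_def)
  have ind: "is_ind K (s + Suc m) (s + Suc m)"
    by (rule window_ind[OF w]) auto
  have "{pd K a b | a b. is_ind K a b} \<subseteq> {..d}" using g by (auto simp: partially_closed_def)
  moreover have "d \<in> {pd K a b | a b. is_ind K a b}"
    using ind pdd[of "s + Suc m" "s + Suc m"] by force
  ultimately show "gldim K = d"
    unfolding gldim_def by (intro Max_eqI) (auto intro: finite_subset)
  have "torsionless_simple K a \<or> pd K a b = d" if "is_ind K a b" for a b
    using g pdd[of a b] that windowD[OF w] by (cases "a \<le> s") (auto simp: partially_closed_def is_ind_def)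
  then show "domdim K = enat d"
    using windowD[OF w] by (intro domdim_eq) auto
qed

section \<open>Identification of the ascent algebra\<close>

lemma ascent_alg_eq:
  assumes "sorted K" "even_head K s ys" "\<forall>y \<in> set ys. odd y"
  shows "ascent_alg (0 # ys) = K"
proof -
  note w = even_headD(1)[OF assms(2)]
  \<comment> \<open>An even bottom simple gets the dimension 0 of P(omega) as its entry, the leading
    0 of the sequence.\<close>
  have "even (pd K s s)"
  proof (cases "ys = []")
    case True
    then show ?thesis using pd_proj[OF window_proj[OF w]] by simp
  next
    case False
    then have "Suc (pd K s s) = ys ! 0" using even_headD(3)[OF assms(2), of 0] by simp
    moreover have "odd (ys ! 0)" using assms(3) False by simp
    ultimately show ?thesis by presburger
  qed
  moreover have "map (\<lambda>j. if odd (pd K j j) then pd K j j else 0) [Suc s..<Suc (s + length ys)] = ys"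
  proof (rule nth_equalityI)
    fix i assume "i < length (map (\<lambda>j. if odd (pd K j j) then pd K j j else 0) [Suc s..<Suc (s + length ys)])"
    then have i: "i < length ys" by (simp del: upt_Suc)
    have "pd K (Suc s + i) (Suc s + i) = ys ! i"
      using even_headD(2)[OF assms(2), of i i] i by simp
    moreover have "odd (ys ! i)" using assms(3) i by simp
    moreover have "[Suc s..<Suc (s + length ys)] ! i = Suc s + i" using i by (simp del: upt_Suc)
    ultimately show "map (\<lambda>j. if odd (pd K j j) then pd K j j else 0) [Suc s..<Suc (s + length ys)] ! i
      = ys ! i"
      using i by (simp del: upt_Suc)
  qed (simp del: upt_Suc)
  moreover have "[s..<Suc (s + length ys)] = s # [Suc s..<Suc (s + length ys)]"
    by (rule upt_rec[THEN trans]) simp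
  ultimately have "char_omega K = 0 # ys"
    unfolding char_omega_window[OF w] by (simp del: upt_Suc)
  then have K: "lin_nakayama K \<and> ascending K \<and> char_omega K = 0 # ys"
    using windowD(1)[OF w] assms(1) by (simp add: ascending_def)
  show ?thesis
    unfolding ascent_alg_def
  proof (rule the_equality, rule K)
    fix L assume "lin_nakayama L \<and> ascending L \<and> char_omega L = 0 # ys"
    then show "L = K" using K char_omega_inj[of L K] by simp
  qed
qed

section \<open>The summits\<close>

text \<open>The maximum m + 2 first occurs at the end of \<open>K\<close>, right after m + 1, so
  that projective has projective radical. Projective radical of a summit means that the Kupisch
  series has just risen, which never happens later.\<close>

lemma first_summit_iff:
  assumes K: "lin_nakayama (K @ E)" "1 \<le> length K"
    and top: "kup K (length K) = m + 2" "m + 2 \<le> length K"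
    and less: "\<And>i. 1 \<le> i \<Longrightarrow> i < length K \<Longrightarrow> kup K i < m + 2"
    and prev: "kup K (length K - 1) = m + 1"
    and fall: "\<And>i j. length K \<le> i \<Longrightarrow> i \<le> j \<Longrightarrow> j \<le> length (K @ E) \<Longrightarrow>
      kup (K @ E) j \<le> kup (K @ E) i"
  shows "first_summit (K @ E) a b \<longleftrightarrow> a = length K - m - 1 \<and> b = length K"
proof -
  let ?H = "K @ E" and ?n = "length K"
  have H: "kup ?H i = kup K i" if "1 \<le> i" "i \<le> ?n" for i using that by (rule kup_append)
  have le: "kup ?H i \<le> m + 2" if "1 \<le> i" "i \<le> length ?H" for i
    using fall[of ?n i] less[of i] H[of i] H[of ?n] that top(1) K(2)
    by (cases i ?n rule: linorder_cases) auto
  have ind: "is_ind ?H (?n - m - 1) ?n" using top H[of ?n] by (auto simp: is_ind_def)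
  have height: "height ?H = m + 2"
    unfolding height_def
  proof (rule Max_eqI)
    have "b + 1 - a \<le> m + 2" if i: "is_ind ?H a b" for a b
    proof -
      have "b + 1 - a \<le> kup ?H b" "1 \<le> b" "b \<le> length ?H" using i by (auto simp: is_ind_def)
      then show ?thesis using le[of b] by linarith
    qed
    then have sub: "{b + 1 - a | a b. is_ind ?H a b} \<subseteq> {..m + 2}" by blast
    then show "finite {b + 1 - a | a b. is_ind ?H a b}" by (rule finite_subset) simp
    show "y \<le> m + 2" if "y \<in> {b + 1 - a | a b. is_ind ?H a b}" for y
      using subsetD[OF sub that] by simp
    have "m + 2 = ?n + 1 - (?n - m - 1)" using top(2) by linarith
    then show "m + 2 \<in> {b + 1 - a | a b. is_ind ?H a b}" using ind by blast
  qed
  show ?thesis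
  proof
    assume fs: "first_summit ?H a b"
    then have ab: "is_ind ?H a b" "b + 1 - a = m + 2"
      by (auto simp: first_summit_def summit_def height)
    then have b: "1 \<le> a" "a < b" "b \<le> length ?H" "m + 2 \<le> kup ?H b" by (auto simp: is_ind_def)
    have "?n \<le> b"
    proof (rule ccontr)
      assume "\<not> ?n \<le> b"
      then show False using less[of b] H[of b] b by linarith
    qed
    have prj: "kup ?H (b - 1) = b - a"
      using fs b by (auto simp: first_summit_def is_proj_ind_def)
    have "b = ?n"
    proof (rule ccontr)
      assume "b \<noteq> ?n"
      then have "kup ?H b \<le> kup ?H (b - 1)" using \<open>?n \<le> b\<close> b by (intro fall) auto
      then show False using prj b ab(2) by linarith
    qed
    then show "a = ?n - m - 1 \<and> b = ?n" using ab b by linarith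
  next
    assume ab: "a = ?n - m - 1 \<and> b = ?n"
    have "is_proj_ind ?H (?n - m - 1) (?n - 1)"
      using top prev H[of "?n - 1"] by (auto simp: is_proj_ind_def is_ind_def)
    moreover have "?n + 1 - (?n - m - 1) = m + 2" using top(2) by simp
    ultimately show "first_summit ?H a b"
      using ab ind by (simp add: first_summit_def summit_def height)
  qed
qed

lemma concave_append:
  assumes "sorted K"
    and "\<And>i j. length K \<le> i \<Longrightarrow> i \<le> j \<Longrightarrow> j \<le> length (K @ E) \<Longrightarrow> kup (K @ E) j \<le> kup (K @ E) i"
  shows "concave (K @ E)"
proof -
  have "kup (K @ E) i \<le> kup (K @ E) j" if "1 \<le> i" "i \<le> j" "j \<le> length K" for i j
  proof -
    have "K ! (i - 1) \<le> K ! (j - 1)" using that assms(1) by (intro sorted_nth_mono) auto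
    then show ?thesis using that by (simp add: kup_append) (simp add: kup_def)
  qed
  then show ?thesis using assms(2) unfolding concave_def by (intro exI[of _ "length K"]) auto
qed

theorem theorem2:
  fixes d :: nat and cs :: "nat list"
  assumes "odd d"
    and "sorted (rev cs)"
    and "\<forall>c \<in> set cs. odd c"
    and "cs \<noteq> [] \<longrightarrow> hd cs \<le> d"
  shows "lin_nakayama (partial_closure d (ascent_alg (0 # cs @ [1])))
       \<and> concave (partial_closure d (ascent_alg (0 # cs @ [1])))
       \<and> higher_auslander (partial_closure d (ascent_alg (0 # cs @ [1])))
       \<and> gldim (partial_closure d (ascent_alg (0 # cs @ [1]))) = d
       \<and> (\<exists>a b. first_summit (partial_closure d (ascent_alg (0 # cs @ [1]))) a b)
       \<and> (\<forall>a b. first_summit (partial_closure d (ascent_alg (0 # cs @ [1]))) a b \<longrightarrow>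
              charseq (partial_closure d (ascent_alg (0 # cs @ [1]))) (Suc a) (b - 1) = cs)"
proof -
  have d: "1 \<le> d" using assms(1) by (cases d) auto
  have le: "c \<le> d" if "c \<in> set cs" for c
    using that assms(2,4) by (cases cs) (fastforce simp: sorted_append)+
  obtain K0 s where K0: "sorted K0" "even_head K0 s cs" "partially_closed d K0 s"
    using ascent_exists[of cs d] assms le d by blast
  let ?m = "length cs"
  \<comment> \<open>The final 1 of the sequence is one growing move: P(omega) of \<open>K\<close>
    has the projective P(omega) of \<open>K0\<close> as radical and will be the first
    summit.\<close>
  define K where "K = K0 @ [?m + 2]"
  note w0 = even_headD(1)[OF K0(2)]
  have hK: "even_head K s (cs @ [1])" unfolding K_def by (rule even_head_grow[OF K0(2)])
  have gK: "partially_closed d K s" unfolding K_def using partially_closed_grow[OF K0(2,3) d] le by blast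
  have lenK: "length K = s + ?m + 1" using windowD[OF w0] by (simp add: K_def)
  have K0_le: "x \<le> ?m + 1" if "x \<in> set K0" for x
  proof -
    have "K0 \<noteq> []" using that by auto
    then have "x \<le> K0 ! (length K0 - 1)"
      using that K0(1) by (cases K0 rule: rev_cases) (auto simp: sorted_append nth_append)
    then show ?thesis using windowD[OF w0] by (simp add: kup_def)
  qed
  have sK: "sorted K" unfolding K_def using K0(1) K0_le by (fastforce simp: sorted_append)
  have asc: "ascent_alg (0 # cs @ [1]) = K"
    using assms(3) by (intro ascent_alg_eq[OF sK hK]) auto
  have dec: "sorted (rev (cs @ [1]))" "\<forall>y \<in> set (cs @ [1]). odd y \<and> y \<le> d"
    using assms(2,3) le d odd_pos by (auto simp: Suc_le_eq)
  obtain H s' m where H: "(ext_step d)\<^sup>*\<^sup>* K H" "even_head H s' (replicate (Suc m) d)" "partially_closed d H s'"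
    using closure_exists[OF hK gK _ dec assms(1)] by auto
  note c = closed_head[OF H(2,3)]
  have pc: "partial_closure d (ascent_alg (0 # cs @ [1])) = H"
    unfolding asc by (rule partial_closure_eq[OF H(1) c(1)])
  obtain E where E: "H = K @ E"
    and fall: "\<And>i j. length K \<le> i \<Longrightarrow> i \<le> j \<Longrightarrow> j \<le> length (K @ E) \<Longrightarrow> kup (K @ E) j \<le> kup (K @ E) i"
    using ext_steps_kupisch[OF H(1)] lenK by auto
  have lin: "lin_nakayama H" using windowD(1)[OF even_headD(1)[OF H(2)]] .
  have fs: "first_summit H a b \<longleftrightarrow> a = s \<and> b = s + ?m + 1" for a b
  proof -
    have "kup K i < ?m + 2" if "1 \<le> i" "i < length K" for i
      using that K0_le[of "K0 ! (i - 1)"] by (simp add: K_def kup_def nth_append)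
    moreover have "kup K (length K) = ?m + 2" "kup K (length K - 1) = ?m + 1"
      using windowD[OF w0] kup_snoc(2)[of K0 "?m + 2"] by (auto simp: K_def kup_snoc)
    ultimately have "first_summit (K @ E) a b \<longleftrightarrow> a = length K - ?m - 1 \<and> b = length K"
      using lin[unfolded E] windowD(2)[OF w0] lenK fall by (intro first_summit_iff) auto
    then show ?thesis by (simp add: E lenK)
  qed
  \<comment> \<open>These are the simples between bottom and top of the window of \<open>K\<close>.
    They are odd, so each contributes its own dimension, which the later extensions do not
    change.\<close>
  have "charseq H (Suc s) (s + ?m) = cs"
  proof (rule nth_equalityI)
    show len: "length (charseq H (Suc s) (s + ?m)) = ?m" by (simp add: charseq_def del: upt_Suc)
    fix i assume "i < length (charseq H (Suc s) (s + ?m))"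
    then have i: "i < ?m" using len by simp
    have "pd H (Suc s + i) (Suc s + i) = cs ! i"
      using even_headD(2)[OF hK, of i i] i lenK by (simp add: E pd_append nth_append)
    moreover have "odd (cs ! i)" using assms(3) i by simp
    ultimately show "charseq H (Suc s) (s + ?m) ! i = cs ! i"
      using i by (simp add: charseq_def del: upt_Suc)
  qed
  then show ?thesis
    unfolding pc using lin concave_append[OF sK fall] c(2,3) fs
    by (auto simp: higher_auslander_def E[symmetric])
qed

end
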